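(* Let $\mathcal E_i$, $i=1,2$, be nonlinear resistance forms on disjoint nonempty sets $X_i$, $i=1,2$, with $\ker\mathcal E_i\supset\mathbb R\cdot1$. For fixed $\xi_i\in X_i$, $i=1,2$, define $\mathcal E\colon\mathcal F(X_1\cup X_2)\to[0,\infty]$ by $$\mathcal E(f)=\begin{cases}\mathcal E_1(f|_{X_1})+\mathcal E_2(f|_{X_2})&\text{if }f|_{X_1}(\xi_1)=f|_{X_2}(\xi_2)\\\infty&\text{else.}\end{cases}$$ Then $\mathcal E$ is a nonlinear resistance form with $\ker\mathcal E\supset\mathbb R\cdot1$, and for $x_i\in X_i$, $i=1,2$, and $t>0$ we have $$\mathcal R_{t,\mathcal E}(x_1,x_2)=\mathcal R_{t,\mathcal E_1}(x_1,\xi_1)+\mathcal R_{t,\mathcal E_2}(\xi_2,x_2).$$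
   Context: For a nonempty set $X$, $\mathcal F(X)$ is the real vector space of all functions $f\colon X\to\mathbb R$, equipped with the topology of pointwise convergence; $\mathbb R\cdot1$ denotes the constant functions. A functional $\mathcal E\colon\mathcal F(X)\to[0,\infty]$ is called a nonlinear resistance form (on $X$) if: (1) $\mathcal E$ is convex with $\mathcal E(0)=0$; (2) $\mathcal E$ is lower semicontinuous with respect to pointwise convergence, i.e. $\mathcal E(f)\le\liminf_i\mathcal E(f_i)$ for every net $f_i\to f$ pointwise; (3) $R(x,y)<\infty$ for all $x,y\in X$, where $R(x,y)=\sup\{f(x)-f(y)\mid\mathcal E(f)\le1\}$; (4) all normal contractions operate on $\mathcal E$, i.e. for every $1$-Lipschitz $C\colon\mathbb R\to\mathbb R$ with $C(0)=0$ and all $f,g\in\mathcal F(X)$, $\mathcal E(f+C\circ g)+\mathcal E(f-C\circ g)\le\mathcal E(f+g)+\mathcal E(f-g)$. $\ker\mathcal E=\{f\in\mathcal F(X)\mid\mathcal E(f)=0\}$. For $t>0$ and $x,y\in X$ the $t$-resistance of $\mathcal E$ is $\mathcal R_{t,\mathcal E}(x,y)=\sup\{t(f(x)-f(y))-\mathcal E(f)\mid f\in\mathcal F(X)\}\in[0,\infty]$. *)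

theory Defs
  imports "HOL-Analysis.Analysis"
begin

text \<open>
  The space of real functions on a set \<open>X\<close> is modelled by the extensional functions on \<open>X\<close>, so a
  function on \<open>X\<close> is determined by its values on \<open>X\<close>, and restriction of functions is
  \<^const>\<open>restrict\<close>. Functionals are total in HOL; only their values on \<open>fun_space X\<close> are ever used.
\<close>

definition fun_space :: "'a set \<Rightarrow> ('a \<Rightarrow> real) set" where
  "fun_space X = X \<rightarrow>\<^sub>E UNIV"

definition pointwise_topology :: "'a set \<Rightarrow> ('a \<Rightarrow> real) topology" where
  "pointwise_topology X = product_topology (\<lambda>_. euclideanreal) X"

definition constants :: "'a set \<Rightarrow> ('a \<Rightarrow> real) set" where
  "constants X = {\<lambda>x\<in>X. c | c. True}"

definition convex_functional :: "'a set \<Rightarrow> (('a \<Rightarrow> real) \<Rightarrow> ennreal) \<Rightarrow> bool" where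
  "convex_functional X E \<longleftrightarrow>
     (\<forall>f\<in>fun_space X. \<forall>g\<in>fun_space X. \<forall>s\<in>{0..1}.
        E (\<lambda>x\<in>X. s * f x + (1 - s) * g x) \<le> ennreal s * E f + ennreal (1 - s) * E g)"

text \<open>
  Nets are represented by filters on the function space: a net \<open>(f\<^sub>i)\<close> corresponds to the image of
  its filter of tails under \<open>i \<mapsto> f\<^sub>i\<close>, which has the same limits, and the Liminf of \<open>E\<close> along
  that filter is the lower limit of \<open>E f\<^sub>i\<close>. This avoids quantifying over index types.
  \<^const>\<open>limitin\<close> forces the limit, and eventually the net, to lie in \<open>fun_space X\<close>.
\<close>

definition lower_semicontinuous_functional ::
    "'a set \<Rightarrow> (('a \<Rightarrow> real) \<Rightarrow> ennreal) \<Rightarrow> bool" where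
  "lower_semicontinuous_functional X E \<longleftrightarrow>
     (\<forall>f F. limitin (pointwise_topology X) (\<lambda>g. g) f F \<longrightarrow> E f \<le> Liminf F E)"

text \<open>
  Both resistances are suprema in \<^typ>\<open>ereal\<close>; they are nonnegative as soon as the functional
  vanishes at the zero function. A function of infinite energy contributes \<open>-\<infinity>\<close> to the
  second supremum.
\<close>

definition resistance :: "'a set \<Rightarrow> (('a \<Rightarrow> real) \<Rightarrow> ennreal) \<Rightarrow> 'a \<Rightarrow> 'a \<Rightarrow> ereal" where
  "resistance X E x y = Sup {ereal (f x - f y) | f. f \<in> fun_space X \<and> E f \<le> 1}"

definition t_resistance ::
    "real \<Rightarrow> 'a set \<Rightarrow> (('a \<Rightarrow> real) \<Rightarrow> ennreal) \<Rightarrow> 'a \<Rightarrow> 'a \<Rightarrow> ereal" where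
  "t_resistance t X E x y =
     Sup {ereal (t * (f x - f y)) - enn2ereal (E f) | f. f \<in> fun_space X}"

definition normal_contractions_operate :: "'a set \<Rightarrow> (('a \<Rightarrow> real) \<Rightarrow> ennreal) \<Rightarrow> bool" where
  "normal_contractions_operate X E \<longleftrightarrow>
     (\<forall>C :: real \<Rightarrow> real. 1-lipschitz_on UNIV C \<and> C 0 = 0 \<longrightarrow>
        (\<forall>f\<in>fun_space X. \<forall>g\<in>fun_space X.
           E (\<lambda>x\<in>X. f x + C (g x)) + E (\<lambda>x\<in>X. f x - C (g x))
             \<le> E (\<lambda>x\<in>X. f x + g x) + E (\<lambda>x\<in>X. f x - g x)))"

definition nonlinear_resistance_form :: "'a set \<Rightarrow> (('a \<Rightarrow> real) \<Rightarrow> ennreal) \<Rightarrow> bool" where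
  "nonlinear_resistance_form X E \<longleftrightarrow>
     X \<noteq> {} \<and>
     convex_functional X E \<and> E (\<lambda>x\<in>X. 0) = 0 \<and>
     lower_semicontinuous_functional X E \<and>
     (\<forall>x\<in>X. \<forall>y\<in>X. resistance X E x y < \<infinity>) \<and>
     normal_contractions_operate X E"

definition form_kernel :: "'a set \<Rightarrow> (('a \<Rightarrow> real) \<Rightarrow> ennreal) \<Rightarrow> ('a \<Rightarrow> real) set" where
  "form_kernel X E = {f \<in> fun_space X. E f = 0}"

definition glued_form ::
    "'a set \<Rightarrow> 'a set \<Rightarrow> 'a \<Rightarrow> 'a \<Rightarrow> (('a \<Rightarrow> real) \<Rightarrow> ennreal) \<Rightarrow> (('a \<Rightarrow> real) \<Rightarrow> ennreal)
      \<Rightarrow> ('a \<Rightarrow> real) \<Rightarrow> ennreal" where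
  "glued_form X1 X2 \<xi>1 \<xi>2 E1 E2 f =
     (if restrict f X1 \<xi>1 = restrict f X2 \<xi>2
      then E1 (restrict f X1) + E2 (restrict f X2) else \<infinity>)"

end

theory Submission
  imports Defs
begin

text \<open>
  A function of finite glued energy is a pair of functions of finite energy agreeing at the
  gluing points, so every defining property passes to the glued form summand by summand. For the
  resistance formula, \<open>f x\<^sub>1 - f x\<^sub>2\<close> splits as
  \<open>(f x\<^sub>1 - f \<xi>\<^sub>1) + (f \<xi>\<^sub>2 - f x\<^sub>2)\<close>. Conversely, arbitrary competitors
  \<open>f\<^sub>1\<close> and \<open>f\<^sub>2\<close> can be made to agree at the gluing points by adding a constant to
  \<open>f\<^sub>2\<close>, which costs no energy since constants lie in the kernel:
  \<open>f + c\<close> is the limit as \<open>s \<rightarrow> 1\<close> of the convex combinations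
  \<open>s f + (1 - s) (c / (1 - s))\<close>.
\<close>

section \<open>Restriction, pointwise convergence and lower limits\<close>

lemma restrict_in_fun_space [simp, intro]: "restrict f X \<in> fun_space X"
  by (auto simp: fun_space_def)

lemma restrict_fun_space: "f \<in> fun_space X \<Longrightarrow> restrict f X = f"
  by (auto simp: fun_space_def PiE_def extensional_restrict)

lemma restrict_restrict_subset: "A \<subseteq> X \<Longrightarrow> restrict (restrict f X) A = restrict f A"
  by (simp add: Int_absorb1)

lemma limitin_pointwise_topology:
  "limitin (pointwise_topology X) h f F \<longleftrightarrow>
     f \<in> fun_space X \<and> (\<forall>\<^sub>F a in F. h a \<in> fun_space X) \<and> (\<forall>x\<in>X. ((\<lambda>a. h a x) \<longlongrightarrow> f x) F)"
  unfolding pointwise_topology_def limitin_componentwise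
  by (auto simp: fun_space_def PiE_iff)

lemma limitin_pointwise_restrict:
  assumes "limitin (pointwise_topology X) h f F" "A \<subseteq> X"
  shows "limitin (pointwise_topology A) (\<lambda>a. restrict (h a) A) (restrict f A) F"
  using assms by (auto simp: limitin_pointwise_topology)

text \<open>If \<open>P\<close> and \<open>Q\<close> hold eventually, so does their conjunction, and
  there the sum of the two infima bounds \<open>f x + g x\<close> from below. Taking suprema over
  \<open>P\<close> and \<open>Q\<close> one after the other is legitimate because in
  \<open>ennreal\<close> adding a fixed value commutes with nonempty suprema.\<close>

lemma Liminf_add_le_ennreal:
  fixes f g :: "'b \<Rightarrow> ennreal"
  shows "Liminf F f + Liminf F g \<le> Liminf F (\<lambda>x. f x + g x)"
proof -
  let ?F = "{P. eventually P F}"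
  have ne: "?F \<noteq> {}"
    by (auto intro: eventually_True)
  have "Inf (f ` Collect P) + Inf (g ` Collect Q) \<le> Liminf F (\<lambda>x. f x + g x)"
    if "P \<in> ?F" "Q \<in> ?F" for P Q
  proof (rule Liminf_bounded)
    have "\<forall>\<^sub>F x in F. P x \<and> Q x"
      using that by (auto intro: eventually_conj)
    then show "\<forall>\<^sub>F x in F. Inf (f ` Collect P) + Inf (g ` Collect Q) \<le> f x + g x"
      by eventually_elim (auto intro!: add_mono INF_lower)
  qed
  then have "Inf (f ` Collect P) + Liminf F g \<le> Liminf F (\<lambda>x. f x + g x)" if "P \<in> ?F" for P
    unfolding Liminf_def[of F g] ennreal_SUP_add_right[OF ne]
    using that by (intro SUP_least)
  then show ?thesis
    unfolding Liminf_def[of F f] ennreal_SUP_add_left[OF ne, symmetric]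
    by (intro SUP_least)
qed

text \<open>Passes from filters on the function space to families with an arbitrary index type: the
  definition is applied to the image filter \<open>filtermap h F\<close>. This serves both the limit
  s \<rightarrow> 1 and the restrictions of a convergent net to one component.\<close>

lemma lower_semicontinuous_functionalD:
  assumes "lower_semicontinuous_functional X E" "limitin (pointwise_topology X) h f F"
  shows "E f \<le> Liminf F (\<lambda>a. E (h a))"
proof -
  have "limitin (pointwise_topology X) (\<lambda>g. g) f (filtermap h F)"
    using assms(2) by (simp add: limitin_pointwise_topology eventually_filtermap filterlim_filtermap)
  then have "E f \<le> Liminf (filtermap h F) E"
    using assms(1) by (simp add: lower_semicontinuous_functional_def)
  also have "\<dots> \<le> Liminf F (\<lambda>a. E (h a))"
    by (rule Liminf_filtermap_le)
  finally show ?thesis .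
qed

section \<open>Energy under addition of constants\<close>

lemma energy_zero:
  assumes "constants X \<subseteq> form_kernel X E"
  shows "E (\<lambda>x\<in>X. c) = 0"
  using assms by (auto simp: constants_def form_kernel_def)

lemma energy_add_const_le:
  assumes conv: "convex_functional X E" and lsc: "lower_semicontinuous_functional X E"
    and const: "constants X \<subseteq> form_kernel X E" and f: "f \<in> fun_space X"
  shows "E (\<lambda>x\<in>X. f x + c) \<le> E f"
proof -
  have le: "E (\<lambda>x\<in>X. s * f x + c) \<le> E f" if s: "0 < s" "s < 1" for s
  proof -
    have "E (\<lambda>x\<in>X. s * f x + (1 - s) * (\<lambda>x\<in>X. c / (1 - s)) x)
        \<le> ennreal s * E f + ennreal (1 - s) * E (\<lambda>x\<in>X. c / (1 - s))"
      using conv f s unfolding convex_functional_def by (auto simp del: restrict_apply)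
    also have "(\<lambda>x\<in>X. s * f x + (1 - s) * (\<lambda>x\<in>X. c / (1 - s)) x) = (\<lambda>x\<in>X. s * f x + c)"
      using s by (auto simp: restrict_def fun_eq_iff)
    also have "ennreal s * E f + ennreal (1 - s) * E (\<lambda>x\<in>X. c / (1 - s)) = ennreal s * E f"
      by (simp add: energy_zero[OF const])
    also have "\<dots> \<le> 1 * E f"
      using s by (intro mult_right_mono) auto
    finally show ?thesis by (simp only: mult_1)
  qed
  have "limitin (pointwise_topology X) (\<lambda>s. \<lambda>x\<in>X. s * f x + c) (\<lambda>x\<in>X. f x + c) (at_left 1)"
    by (auto simp: limitin_pointwise_topology intro!: tendsto_eq_intros)
  then have "E (\<lambda>x\<in>X. f x + c) \<le> Liminf (at_left 1) (\<lambda>s. E (\<lambda>x\<in>X. s * f x + c))"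
    by (rule lower_semicontinuous_functionalD[OF lsc])
  also have "\<dots> \<le> E f"
  \<comment> \<open>Bounding a lower limit from above also requires a nontrivial filter; the closing
    \<open>simp\<close> settles this for \<open>at_left 1\<close>.\<close>
  proof (rule Liminf_le)
    have "\<forall>\<^sub>F s in at_left (1::real). s \<in> {0<..<1}"
      by (rule eventually_at_left_real) simp
    then show "\<forall>\<^sub>F s in at_left 1. E (\<lambda>x\<in>X. s * f x + c) \<le> E f"
      by eventually_elim (simp add: le)
  qed simp
  finally show ?thesis .
qed

section \<open>Resistances as suprema\<close>

lemma resistance_upper:
  "f \<in> fun_space X \<Longrightarrow> E f \<le> 1 \<Longrightarrow> ereal (f x - f y) \<le> resistance X E x y"
  unfolding resistance_def by (rule Sup_upper) auto

text \<open>
  Dropping the functions of infinite energy is only harmless because some function has finite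
  energy. It keeps \<open>-\<infinity> + \<infinity> = \<infinity>\<close> out of sums of suprema.
\<close>

lemma t_resistance_finite_energy:
  assumes "E (\<lambda>x\<in>X. 0) = 0"
  shows "t_resistance t X E x y =
    (SUP f\<in>{f \<in> fun_space X. E f \<noteq> \<infinity>}. ereal (t * (f x - f y) - enn2real (E f)))"
    (is "_ = (SUP f\<in>?A. ?v f)")
proof -
  have v: "ereal (t * (f x - f y)) - enn2ereal (E f) = ?v f" if "E f \<noteq> \<infinity>" for f
    using that by (cases "E f") (auto simp: ereal_minus(1))
  show ?thesis
  proof (rule antisym)
    show "t_resistance t X E x y \<le> (SUP f\<in>?A. ?v f)"
      unfolding t_resistance_def
    proof (rule Sup_least, clarify)
      fix f assume f: "f \<in> fun_space X"
      show "ereal (t * (f x - f y)) - enn2ereal (E f) \<le> (SUP f\<in>?A. ?v f)"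
      proof (cases "E f = \<infinity>")
        case False
        then show ?thesis using f by (auto simp: v intro!: SUP_upper)
      qed simp
    qed
    show "(SUP f\<in>?A. ?v f) \<le> t_resistance t X E x y"
      unfolding t_resistance_def by (rule SUP_least, rule Sup_upper) (use v in force)
  qed
qed

text \<open>Both suprema run over nonempty sets of real numbers, so neither is -\<infinity>, and
  addition can be moved inside them one at a time.\<close>

lemma SUP_add_SUP_le_ereal:
  fixes u :: "'b \<Rightarrow> real" and v :: "'c \<Rightarrow> real"
  assumes "A \<noteq> {}" "B \<noteq> {}"
    and le: "\<And>a b. a \<in> A \<Longrightarrow> b \<in> B \<Longrightarrow> ereal (u a + v b) \<le> S"
  shows "(SUP a\<in>A. ereal (u a)) + (SUP b\<in>B. ereal (v b)) \<le> S"
proof -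
  have "(SUP b\<in>B. ereal (v b)) \<noteq> -\<infinity>"
    using assms(2) by (auto simp: SUP_eq_iff Sup_eq_MInfty)
  then have "(SUP a\<in>A. ereal (u a)) + (SUP b\<in>B. ereal (v b))
      = (SUP a\<in>A. ereal (u a) + (SUP b\<in>B. ereal (v b)))"
    using assms(1) by (simp add: SUP_ereal_add_left)
  also have "\<dots> = (SUP a\<in>A. SUP b\<in>B. ereal (u a) + ereal (v b))"
    by (intro SUP_cong refl SUP_ereal_add_right[symmetric] assms) simp
  also have "\<dots> \<le> S"
    using le by (auto intro!: SUP_least)
  finally show ?thesis .
qed

section \<open>The glued form and its defining properties\<close>

locale resistance_form_gluing =
  fixes X1 X2 :: "'a set" and E1 E2 :: "('a \<Rightarrow> real) \<Rightarrow> ennreal" and \<xi>1 \<xi>2 :: 'a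
  assumes disj: "X1 \<inter> X2 = {}"
    and form1: "nonlinear_resistance_form X1 E1"
    and form2: "nonlinear_resistance_form X2 E2"
    and const1: "constants X1 \<subseteq> form_kernel X1 E1"
    and const2: "constants X2 \<subseteq> form_kernel X2 E2"
    and xi1: "\<xi>1 \<in> X1" and xi2: "\<xi>2 \<in> X2"
begin

abbreviation X where "X \<equiv> X1 \<union> X2"

abbreviation E where "E \<equiv> glued_form X1 X2 \<xi>1 \<xi>2 E1 E2"

lemma restrict_X [simp]:
  "restrict (restrict f X) X1 = restrict f X1" "restrict (restrict f X) X2 = restrict f X2"
  by (simp_all add: restrict_restrict_subset)

lemma E_eq: "E f = (if f \<xi>1 = f \<xi>2 then E1 (restrict f X1) + E2 (restrict f X2) else \<infinity>)"
  using xi1 xi2 by (simp add: glued_form_def)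

text \<open>The defining properties evaluate \<open>E\<close> at functions of the shape
  \<open>restrict f X\<close>; here the gluing condition and both energies are read off from
  \<open>f\<close> itself.\<close>

lemma E_restrict:
  "E (restrict f X) = (if f \<xi>1 = f \<xi>2 then E1 (restrict f X1) + E2 (restrict f X2) else \<infinity>)"
  using xi1 xi2 by (simp only: E_eq restrict_X) simp

lemma E_ge: "E1 (restrict f X1) + E2 (restrict f X2) \<le> E f"
  by (simp add: E_eq)

lemma E_const: "E (\<lambda>x\<in>X. c) = 0"
  by (simp add: E_restrict energy_zero[OF const1] energy_zero[OF const2])

lemma convex: "convex_functional X E"
  unfolding convex_functional_def
proof (intro ballI)
  fix f g s assume f: "f \<in> fun_space X" and g: "g \<in> fun_space X" and s: "s \<in> {0..1::real}"
  have conv: "E' (\<lambda>x\<in>Y. s * f x + (1 - s) * g x)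
      \<le> ennreal s * E' (restrict f Y) + ennreal (1 - s) * E' (restrict g Y)"
    if "nonlinear_resistance_form Y E'" for Y E'
  proof -
    have "E' (\<lambda>x\<in>Y. s * restrict f Y x + (1 - s) * restrict g Y x)
      \<le> ennreal s * E' (restrict f Y) + ennreal (1 - s) * E' (restrict g Y)"
      using that s unfolding nonlinear_resistance_form_def convex_functional_def
      by (auto simp del: restrict_apply)
    then show ?thesis by (simp cong: restrict_cong)
  qed
  \<comment> \<open>The endpoints are separate because 0 * \<infinity> = 0 in
    \<open>ennreal\<close>: there the right-hand side can be finite although one function violates
    the gluing condition. For 0 < s < 1 such a violation makes it infinite.\<close>
  consider "s = 0" | "s = 1" | "0 < s" "s < 1" "f \<xi>1 = f \<xi>2" "g \<xi>1 = g \<xi>2"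
    | "0 < s" "s < 1" "f \<xi>1 \<noteq> f \<xi>2 \<or> g \<xi>1 \<noteq> g \<xi>2"
    using s by force
  then show "E (\<lambda>x\<in>X. s * f x + (1 - s) * g x) \<le> ennreal s * E f + ennreal (1 - s) * E g"
  proof cases
    case 3
    then have "E (\<lambda>x\<in>X. s * f x + (1 - s) * g x)
      = E1 (\<lambda>x\<in>X1. s * f x + (1 - s) * g x) + E2 (\<lambda>x\<in>X2. s * f x + (1 - s) * g x)"
      by (simp add: E_restrict)
    also have "\<dots> \<le> (ennreal s * E1 (restrict f X1) + ennreal (1 - s) * E1 (restrict g X1))
        + (ennreal s * E2 (restrict f X2) + ennreal (1 - s) * E2 (restrict g X2))"
      by (intro add_mono conv form1 form2)
    also have "\<dots> = ennreal s * E f + ennreal (1 - s) * E g"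
      using 3 by (simp add: E_eq distrib_left add_ac)
    finally show ?thesis .
  next
    case 4
    then have top: "ennreal s * E f + ennreal (1 - s) * E g = \<infinity>"
      by (auto simp: E_eq ennreal_mult_top)
    show ?thesis
      unfolding top by simp
  qed (use f g in \<open>simp_all add: restrict_fun_space\<close>)
qed

lemma lower_semicontinuous: "lower_semicontinuous_functional X E"
  unfolding lower_semicontinuous_functional_def
proof (intro allI impI)
  fix f F assume lim: "limitin (pointwise_topology X) (\<lambda>g. g) f F"
  show "E f \<le> Liminf F E"
  proof (cases "f \<xi>1 = f \<xi>2")
    case True
    have "E1 (restrict f X1) \<le> Liminf F (\<lambda>g. E1 (restrict g X1))"
      using form1 limitin_pointwise_restrict[OF lim]
      by (auto simp: nonlinear_resistance_form_def intro!: lower_semicontinuous_functionalD)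
    moreover have "E2 (restrict f X2) \<le> Liminf F (\<lambda>g. E2 (restrict g X2))"
      using form2 limitin_pointwise_restrict[OF lim]
      by (auto simp: nonlinear_resistance_form_def intro!: lower_semicontinuous_functionalD)
    ultimately have "E f \<le> Liminf F (\<lambda>g. E1 (restrict g X1)) + Liminf F (\<lambda>g. E2 (restrict g X2))"
      using True by (simp add: E_eq add_mono)
    also have "\<dots> \<le> Liminf F (\<lambda>g. E1 (restrict g X1) + E2 (restrict g X2))"
      by (rule Liminf_add_le_ennreal)
    also have "\<dots> \<le> Liminf F E"
      by (intro Liminf_mono always_eventually allI E_ge)
    finally show ?thesis .
  next
    case False
    \<comment> \<open>The gluing condition is closed under pointwise convergence: if the limit
      violates it, the net eventually does too and has infinite energy from then on.\<close>
    have "((\<lambda>g. g \<xi>1 - g \<xi>2) \<longlongrightarrow> f \<xi>1 - f \<xi>2) F"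
      using lim xi1 xi2 by (auto simp: limitin_pointwise_topology intro!: tendsto_diff)
    then have "\<forall>\<^sub>F g in F. g \<xi>1 - g \<xi>2 \<noteq> 0"
      using False by (intro tendsto_imp_eventually_ne) auto
    then have "\<infinity> \<le> Liminf F E"
      by (intro Liminf_bounded) (auto simp: E_eq elim!: eventually_mono)
    then show ?thesis by (simp add: top_unique)
  qed
qed

text \<open>Energy at most 1 forces the gluing condition and bounds both partial energies by 1.
  Differences within one component are then controlled by its own resistance, and differences across
  components by a path through the gluing points.\<close>

lemma resistance_finite:
  assumes "x \<in> X" "y \<in> X"
  shows "resistance X E x y < \<infinity>"
proof -
  have energy: "f \<xi>1 = f \<xi>2 \<and> E1 (restrict f X1) \<le> 1 \<and> E2 (restrict f X2) \<le> 1"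
    if "E f \<le> 1" for f
  proof (intro conjI)
    show "f \<xi>1 = f \<xi>2"
      using that by (auto simp: E_eq top_unique split: if_splits)
    show "E1 (restrict f X1) \<le> 1" "E2 (restrict f X2) \<le> 1"
      using order_trans[OF E_ge that] by (auto elim: order_trans[rotated])
  qed
  have fin: "resistance X1 E1 a b < \<infinity>" if "a \<in> X1" "b \<in> X1" for a b
    using form1 that by (auto simp: nonlinear_resistance_form_def)
  have fin': "resistance X2 E2 a b < \<infinity>" if "a \<in> X2" "b \<in> X2" for a b
    using form2 that by (auto simp: nonlinear_resistance_form_def)
  have up: "ereal (f a - f b) \<le> resistance X1 E1 a b" if "E f \<le> 1" "a \<in> X1" "b \<in> X1" for f a b
    using resistance_upper[of "restrict f X1" X1 E1 a b] energy[OF that(1)] that by auto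
  have up': "ereal (f a - f b) \<le> resistance X2 E2 a b" if "E f \<le> 1" "a \<in> X2" "b \<in> X2" for f a b
    using resistance_upper[of "restrict f X2" X2 E2 a b] energy[OF that(1)] that by auto
  consider "x \<in> X1" "y \<in> X1" | "x \<in> X2" "y \<in> X2" | "x \<in> X1" "y \<in> X2" | "x \<in> X2" "y \<in> X1"
    using assms by blast
  then show ?thesis
  proof cases
    case 1
    then have "resistance X E x y \<le> resistance X1 E1 x y"
      unfolding resistance_def[of X] by (auto intro!: Sup_least up)
    then show ?thesis using fin[OF 1] by (rule order.strict_trans1)
  next
    case 2
    then have "resistance X E x y \<le> resistance X2 E2 x y"
      unfolding resistance_def[of X] by (auto intro!: Sup_least up')
    then show ?thesis using fin'[OF 2] by (rule order.strict_trans1)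
  next
    case 3
    have "ereal (f x - f y) \<le> resistance X1 E1 x \<xi>1 + resistance X2 E2 \<xi>2 y" if "E f \<le> 1" for f
      using add_mono[OF up[OF that 3(1) xi1] up'[OF that xi2 3(2)]] energy[OF that] by simp
    then have "resistance X E x y \<le> resistance X1 E1 x \<xi>1 + resistance X2 E2 \<xi>2 y"
      unfolding resistance_def[of X] by (auto intro!: Sup_least)
    then show ?thesis
      using fin[OF 3(1) xi1] fin'[OF xi2 3(2)] by auto
  next
    case 4
    have "ereal (f x - f y) \<le> resistance X2 E2 x \<xi>2 + resistance X1 E1 \<xi>1 y" if "E f \<le> 1" for f
      using add_mono[OF up'[OF that 4(1) xi2] up[OF that xi1 4(2)]] energy[OF that] by simp
    then have "resistance X E x y \<le> resistance X2 E2 x \<xi>2 + resistance X1 E1 \<xi>1 y"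
      unfolding resistance_def[of X] by (auto intro!: Sup_least)
    then show ?thesis
      using fin[OF xi1 4(2)] fin'[OF 4(1) xi2] by auto
  qed
qed

lemma contractions: "normal_contractions_operate X E"
  unfolding normal_contractions_operate_def
proof (intro allI impI ballI)
  fix C :: "real \<Rightarrow> real" and f g :: "'a \<Rightarrow> real"
  assume C: "1-lipschitz_on UNIV C \<and> C 0 = 0"
  have contr: "E' (\<lambda>x\<in>Y. f x + C (g x)) + E' (\<lambda>x\<in>Y. f x - C (g x))
      \<le> E' (\<lambda>x\<in>Y. f x + g x) + E' (\<lambda>x\<in>Y. f x - g x)"
    if "nonlinear_resistance_form Y E'" for Y E'
  proof -
    have "E' (\<lambda>x\<in>Y. restrict f Y x + C (restrict g Y x)) + E' (\<lambda>x\<in>Y. restrict f Y x - C (restrict g Y x))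
      \<le> E' (\<lambda>x\<in>Y. restrict f Y x + restrict g Y x) + E' (\<lambda>x\<in>Y. restrict f Y x - restrict g Y x)"
      using that C unfolding nonlinear_resistance_form_def normal_contractions_operate_def
      by (blast intro: restrict_in_fun_space)
    then show ?thesis by (simp cong: restrict_cong)
  qed
  show "E (\<lambda>x\<in>X. f x + C (g x)) + E (\<lambda>x\<in>X. f x - C (g x))
      \<le> E (\<lambda>x\<in>X. f x + g x) + E (\<lambda>x\<in>X. f x - g x)"
  \<comment> \<open>If both \<open>f + g\<close> and \<open>f - g\<close> satisfy the gluing
    condition, so do \<open>f\<close> and \<open>g\<close>, hence also \<open>f\<close> plus or
    minus \<open>C\<close> applied to \<open>g\<close>. Otherwise the right-hand side is
    infinite.\<close>
  proof (cases "f \<xi>1 + g \<xi>1 = f \<xi>2 + g \<xi>2 \<and> f \<xi>1 - g \<xi>1 = f \<xi>2 - g \<xi>2")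
    case True
    then have eq: "f \<xi>1 = f \<xi>2" "g \<xi>1 = g \<xi>2"
      by linarith+
    show ?thesis
      using add_mono[OF contr[OF form1] contr[OF form2]] by (simp add: E_restrict eq add_ac)
  next
    case False
    then show ?thesis by (auto simp: E_restrict)
  qed
qed

lemma glued_resistance_form: "nonlinear_resistance_form X E"
  using convex lower_semicontinuous resistance_finite contractions E_const xi1
  by (auto simp: nonlinear_resistance_form_def)

lemma glued_kernel: "constants X \<subseteq> form_kernel X E"
  using E_const by (auto simp: constants_def form_kernel_def)

section \<open>The t-resistance between the two components\<close>

lemma t_resistance_glued:
  assumes x1: "x1 \<in> X1" and x2: "x2 \<in> X2"
  shows "t_resistance t X E x1 x2 = t_resistance t X1 E1 x1 \<xi>1 + t_resistance t X2 E2 \<xi>2 x2"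
proof (rule antisym)
  note t1 = t_resistance_finite_energy[where X = X1 and E = E1, OF energy_zero[OF const1]]
    and t2 = t_resistance_finite_energy[where X = X2 and E = E2, OF energy_zero[OF const2]]
    and tE = t_resistance_finite_energy[where X = X and E = E, OF E_const]
  show "t_resistance t X E x1 x2 \<le> t_resistance t X1 E1 x1 \<xi>1 + t_resistance t X2 E2 \<xi>2 x2"
    unfolding tE
  proof (rule SUP_least, clarify)
    fix f assume f: "f \<in> fun_space X" and "E f \<noteq> \<infinity>"
    then have eq: "f \<xi>1 = f \<xi>2" and fin: "E1 (restrict f X1) \<noteq> \<infinity>" "E2 (restrict f X2) \<noteq> \<infinity>"
      by (auto simp: E_eq split: if_splits)
    have "ereal (t * (f x1 - f \<xi>1) - enn2real (E1 (restrict f X1))) \<le> t_resistance t X1 E1 x1 \<xi>1"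
      unfolding t1 by (rule SUP_upper2[of "restrict f X1"]) (use fin x1 xi1 in auto)
    moreover
    have "ereal (t * (f \<xi>2 - f x2) - enn2real (E2 (restrict f X2))) \<le> t_resistance t X2 E2 \<xi>2 x2"
      unfolding t2 by (rule SUP_upper2[of "restrict f X2"]) (use fin x2 xi2 in auto)
    ultimately have "ereal (t * (f x1 - f \<xi>1) - enn2real (E1 (restrict f X1))
        + (t * (f \<xi>2 - f x2) - enn2real (E2 (restrict f X2))))
      \<le> t_resistance t X1 E1 x1 \<xi>1 + t_resistance t X2 E2 \<xi>2 x2"
      using add_mono by fastforce
    \<comment> \<open>The values at the gluing points cancel by \<open>eq\<close>, and
      \<open>enn2real\<close> is additive because both energies are finite.\<close>
    also have "t * (f x1 - f \<xi>1) - enn2real (E1 (restrict f X1))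
        + (t * (f \<xi>2 - f x2) - enn2real (E2 (restrict f X2))) = t * (f x1 - f x2) - enn2real (E f)"
      using fin by (simp add: E_eq eq enn2real_plus top.not_eq_extremum algebra_simps)
    finally show "ereal (t * (f x1 - f x2) - enn2real (E f))
      \<le> t_resistance t X1 E1 x1 \<xi>1 + t_resistance t X2 E2 \<xi>2 x2" .
  qed
  show "t_resistance t X1 E1 x1 \<xi>1 + t_resistance t X2 E2 \<xi>2 x2 \<le> t_resistance t X E x1 x2"
    unfolding t1 t2
  proof (rule SUP_add_SUP_le_ereal)
    show "{f \<in> fun_space X1. E1 f \<noteq> \<infinity>} \<noteq> {}" "{f \<in> fun_space X2. E2 f \<noteq> \<infinity>} \<noteq> {}"
      using energy_zero[OF const1, of 0] energy_zero[OF const2, of 0] by force+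
  next
    fix f g
    assume "f \<in> {f \<in> fun_space X1. E1 f \<noteq> \<infinity>}" "g \<in> {f \<in> fun_space X2. E2 f \<noteq> \<infinity>}"
    then have f: "f \<in> fun_space X1" "E1 f < \<infinity>" and g: "g \<in> fun_space X2" "E2 g < \<infinity>"
      by (auto simp: top.not_eq_extremum)
    \<comment> \<open>The shift gives \<open>g'\<close> the value \<open>f \<xi>1\<close> at
      \<open>\<xi>2\<close>, so that \<open>f\<close> and \<open>g'\<close> can be glued.\<close>
    define g' where "g' = (\<lambda>x\<in>X2. g x + (f \<xi>1 - g \<xi>2))"
    define h where "h = (\<lambda>x\<in>X. if x \<in> X1 then f x else g' x)"
    have g': "E2 g' \<le> E2 g"
      unfolding g'_def using form2 const2 g
      by (intro energy_add_const_le) (auto simp: nonlinear_resistance_form_def)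
    have notin: "x \<notin> X1" if "x \<in> X2" for x
      using disj that by blast
    have "restrict h X1 = f"
      unfolding h_def restrict_X using restrict_fun_space[OF f(1)] by (simp cong: restrict_cong)
    moreover have "restrict h X2 = g'"
      unfolding h_def restrict_X by (simp add: notin g'_def cong: restrict_cong)
    moreover have "h \<xi>1 = h \<xi>2"
      using xi1 xi2 by (simp add: h_def notin g'_def)
    ultimately have Eh: "E h = E1 f + E2 g'"
      by (simp add: E_eq)
    \<comment> \<open>Finiteness of the right-hand side is what lets \<open>enn2real\<close>
      preserve this inequality, since it sends \<infinity> to 0.\<close>
    have le: "E h \<le> E1 f + E2 g"
      unfolding Eh using g' by (rule add_left_mono)
    have sum: "E1 f + E2 g < \<infinity>"
      using f g by simp
    have "enn2real (E h) \<le> enn2real (E1 f) + enn2real (E2 g)"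
      using enn2real_mono[OF le] f g sum by (simp add: enn2real_plus)
    \<comment> \<open>By the choice of the shift, \<open>h x2\<close> equals
      \<open>g x2 + f \<xi>1 - g \<xi>2\<close>.\<close>
    moreover have "t * (h x1 - h x2) = t * (f x1 - f \<xi>1) + t * (g \<xi>2 - g x2)"
      using x1 x2 by (simp add: h_def notin g'_def algebra_simps)
    ultimately have "t * (f x1 - f \<xi>1) - enn2real (E1 f) + (t * (g \<xi>2 - g x2) - enn2real (E2 g))
        \<le> t * (h x1 - h x2) - enn2real (E h)"
      by linarith
    moreover have "ereal (t * (h x1 - h x2) - enn2real (E h)) \<le> t_resistance t X E x1 x2"
      unfolding tE
    proof (rule SUP_upper)
      have "h \<in> fun_space X"
        unfolding h_def by (rule restrict_in_fun_space)
      moreover have "E h \<noteq> \<infinity>"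
        using order.strict_trans1[OF le sum] by simp
      ultimately show "h \<in> {f \<in> fun_space X. E f \<noteq> \<infinity>}"
        by blast
    qed
    ultimately show "ereal (t * (f x1 - f \<xi>1) - enn2real (E1 f)
        + (t * (g \<xi>2 - g x2) - enn2real (E2 g))) \<le> t_resistance t X E x1 x2"
      by (meson ereal_less_eq(3) order_trans)
  qed
qed

end

theorem theorem4p17:
  fixes X1 X2 :: "'a set"
    and E1 E2 E :: "('a \<Rightarrow> real) \<Rightarrow> ennreal"
    and \<xi>1 \<xi>2 :: 'a
  assumes "X1 \<noteq> {}" and "X2 \<noteq> {}" and "X1 \<inter> X2 = {}"
    and "nonlinear_resistance_form X1 E1"
    and "nonlinear_resistance_form X2 E2"
    and "constants X1 \<subseteq> form_kernel X1 E1"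
    and "constants X2 \<subseteq> form_kernel X2 E2"
    and "\<xi>1 \<in> X1" and "\<xi>2 \<in> X2"
  defines "E \<equiv> glued_form X1 X2 \<xi>1 \<xi>2 E1 E2"
  shows "nonlinear_resistance_form (X1 \<union> X2) E
    \<and> constants (X1 \<union> X2) \<subseteq> form_kernel (X1 \<union> X2) E
    \<and> (\<forall>x1\<in>X1. \<forall>x2\<in>X2. \<forall>t>0.
         t_resistance t (X1 \<union> X2) E x1 x2
           = t_resistance t X1 E1 x1 \<xi>1 + t_resistance t X2 E2 \<xi>2 x2)"
proof -
  interpret resistance_form_gluing X1 X2 E1 E2 \<xi>1 \<xi>2
    using assms by unfold_locales
  show ?thesis
    unfolding E_def using glued_resistance_form glued_kernel t_resistance_glued by blast
qed

end
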